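(* Let $S$ be a semigroup. If the intersection ideal graph $\Gamma(S)$ is connected, then $\operatorname{diam}(\Gamma(S))\leq 2$.
   Context: A left ideal of a semigroup $S$ is a non-empty subset $I\subseteq S$ with $SI\subseteq I$; it is nontrivial if $I\neq S$. The intersection of two left ideals is nontrivial if it is non-empty. The intersection ideal graph $\Gamma(S)$ is the simple undirected graph whose vertices are the nontrivial left ideals of $S$, with two distinct vertices $I,J$ adjacent if and only if $I\cap J$ is nontrivial. The diameter is the greatest distance between any pair of vertices. *)

theory Defs
  imports "Graph_Theory.Graph_Theory"
begin

definition left_ideal :: "'a::semigroup_mult set \<Rightarrow> bool" where
  "left_ideal I \<longleftrightarrow> I \<noteq> {} \<and> (\<forall>s. \<forall>x\<in>I. s * x \<in> I)"

definition nontrivial_left_ideal :: "'a::semigroup_mult set \<Rightarrow> bool" where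
  "nontrivial_left_ideal I \<longleftrightarrow> left_ideal I \<and> I \<noteq> UNIV"

text \<open>
  The semigroup is the universe of a type of class \<^class>\<open>semigroup_mult\<close>; the itself-argument
  names that type.  As is usual with Graph_Theory, an undirected edge is represented by the
  two opposite arcs between its ends.
\<close>

definition intersection_ideal_graph ::
    "'a::semigroup_mult itself \<Rightarrow> 'a set pair_pre_digraph" where
  "intersection_ideal_graph S =
     \<lparr> pverts = {I. nontrivial_left_ideal I},
       parcs = {(I, J). nontrivial_left_ideal I \<and> nontrivial_left_ideal J \<and>
                        I \<noteq> J \<and> I \<inter> J \<noteq> {}} \<rparr>"

lemma pair_bidirected_digraph_intersection_ideal_graph:
  "pair_bidirected_digraph (intersection_ideal_graph S)"
  by unfold_locales
    (auto simp: intersection_ideal_graph_def symmetric_def intro!: symI)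

text \<open>
  With unit weights, \<^const>\<open>wf_digraph.\<mu>\<close> is the least number of arcs on a walk between two
  vertices, and \<open>\<infinity>\<close> if there is none.  The supremum is taken in the extended reals, so a graph
  with unbounded distances has diameter \<open>\<infinity>\<close>.
\<close>

definition graph_distance :: "('v, 'e) pre_digraph \<Rightarrow> 'v \<Rightarrow> 'v \<Rightarrow> ereal" where
  "graph_distance G u v = wf_digraph.\<mu> G (\<lambda>_. 1) u v"

definition diameter :: "('v, 'e) pre_digraph \<Rightarrow> ereal" where
  "diameter G = (SUP u\<in>verts G. SUP v\<in>verts G. graph_distance G u v)"

end

theory Submission
  imports Defs
begin

text \<open>
  Two disjoint vertices \<open>I\<close> and \<open>J\<close> are both adjacent to \<open>I \<union> J\<close>, unless \<open>I \<union> J\<close> is the whole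
  semigroup.  In that case take a walk from \<open>I\<close> to \<open>J\<close>: its first vertex that is not contained
  in \<open>I\<close> meets the preceding vertex, hence \<open>I\<close>, and also meets the complement \<open>J\<close> of \<open>I\<close>.
\<close>

lemma left_ideal_Un: "left_ideal I \<Longrightarrow> left_ideal J \<Longrightarrow> left_ideal (I \<union> J)"
  by (auto simp: left_ideal_def)

lemma nontrivial_left_ideal_nonempty: "nontrivial_left_ideal I \<Longrightarrow> I \<noteq> {}"
  by (simp add: nontrivial_left_ideal_def left_ideal_def)

lemma parcs_intersection_ideal_graph_iff:
  "(I, J) \<in> parcs (intersection_ideal_graph S) \<longleftrightarrow>
     nontrivial_left_ideal I \<and> nontrivial_left_ideal J \<and> I \<noteq> J \<and> I \<inter> J \<noteq> {}"
  by (simp add: intersection_ideal_graph_def)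

lemma pverts_intersection_ideal_graph_iff:
  "I \<in> pverts (intersection_ideal_graph S) \<longleftrightarrow> nontrivial_left_ideal I"
  by (simp add: intersection_ideal_graph_def)

lemma pair_sym_digraph_intersection_ideal_graph:
  "pair_sym_digraph (intersection_ideal_graph S)"
  using pair_bidirected_digraph_intersection_ideal_graph
  by (rule pair_bidirected_digraph.axioms(1))

lemma wf_digraph_intersection_ideal_graph:
  "wf_digraph (with_proj (intersection_ideal_graph S))"
  by unfold_locales (auto simp: intersection_ideal_graph_def)

text \<open>\<open>connected\<close> means strong connectivity of the symmetric closure; the arcs
  being symmetric already, passing to the closure does not change reachability.\<close>

lemma sym_digraph_connected_reachable:
  assumes "sym_digraph G" "connected G" "u \<in> verts G" "v \<in> verts G"
  shows "u \<rightarrow>\<^sup>*\<^bsub>G\<^esub> v"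
proof -
  interpret sym_digraph G by fact
  show ?thesis
    using assms(2-4) reachable_mk_symmetric_eq[OF sym_arcs]
    by (auto simp: connected_def strongly_connected_def)
qed

lemma reachable_subset_or_leaves:
  assumes "I \<rightarrow>\<^sup>*\<^bsub>with_proj (intersection_ideal_graph S)\<^esub> J"
  shows "J \<subseteq> I \<or> (\<exists>K. nontrivial_left_ideal K \<and> K \<inter> I \<noteq> {} \<and> \<not> K \<subseteq> I)"
proof -
  interpret wf_digraph "with_proj (intersection_ideal_graph S)"
    by (rule wf_digraph_intersection_ideal_graph)
  show ?thesis
    using assms
  proof (induction rule: reachable_induct)
    case base
    then show ?case by simp
  next
    case (step K L)
    then have "nontrivial_left_ideal L" "K \<inter> L \<noteq> {}"
      by (simp_all add: parcs_intersection_ideal_graph_iff)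
    \<comment> \<open>If \<open>K \<subseteq> I\<close>, then \<open>L\<close> meets
      \<open>I\<close> through \<open>K\<close>, so \<open>L\<close> either stays inside
      \<open>I\<close> or is itself the required witness. A witness found earlier on the walk is
      kept.\<close>
    with step.IH show ?case by blast
  qed
qed

text \<open>Distinctness of \<open>K\<close> from \<open>I\<close> and \<open>J\<close> comes for
  free: \<open>K\<close> meets both, and they are disjoint.\<close>

lemma disjoint_common_neighbour:
  fixes S :: "'a::semigroup_mult itself"
  assumes conn: "connected (with_proj (intersection_ideal_graph S))"
    and I: "nontrivial_left_ideal (I :: 'a set)" and J: "nontrivial_left_ideal J"
    and disj: "I \<inter> J = {}"
  obtains K where "nontrivial_left_ideal K" "K \<inter> I \<noteq> {}" "K \<inter> J \<noteq> {}"
proof (cases "I \<union> J = UNIV")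
  case False
  with I J have "nontrivial_left_ideal (I \<union> J)"
    by (simp add: nontrivial_left_ideal_def left_ideal_Un)
  moreover have "(I \<union> J) \<inter> I \<noteq> {}" "(I \<union> J) \<inter> J \<noteq> {}"
    using I J by (auto dest: nontrivial_left_ideal_nonempty)
  ultimately show thesis
    by (rule that)
next
  case True
  interpret pair_sym_digraph "intersection_ideal_graph S"
    by (rule pair_sym_digraph_intersection_ideal_graph)
  have reach: "I \<rightarrow>\<^sup>*\<^bsub>with_proj (intersection_ideal_graph S)\<^esub> J"
    using I J
    by (intro sym_digraph_connected_reachable conn sym_digraph_axioms)
      (simp_all add: pverts_intersection_ideal_graph_iff)
  have "\<not> J \<subseteq> I"
    using disj nontrivial_left_ideal_nonempty[OF J] by blast
  with reachable_subset_or_leaves[OF reach]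
  obtain K where K: "nontrivial_left_ideal K" "K \<inter> I \<noteq> {}" "\<not> K \<subseteq> I"
    by auto
  \<comment> \<open>Since \<open>I\<close> and \<open>J\<close> cover the semigroup, a point of
    \<open>K\<close> outside \<open>I\<close> lies in \<open>J\<close>.\<close>
  have "K \<inter> J \<noteq> {}"
    using K(3) True by blast
  with K(1,2) show thesis
    by (rule that)
qed

text \<open>The distance is an infimum of walk costs, and with unit weights the cost of a walk is
  its number of arcs.\<close>

lemma graph_distance_le_length:
  assumes "wf_digraph G" "pre_digraph.awalk G u p v"
  shows "graph_distance G u v \<le> length p"
proof -
  interpret wf_digraph G by fact
  have "awalk_cost (\<lambda>_. 1) p = length p"
    by (simp add: awalk_cost_def sum_list_triv)
  with min_cost_le_walk_cost[OF assms(2), of "\<lambda>_. 1"] show ?thesis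
    by (simp add: graph_distance_def)
qed

lemma graph_distance_intersection_ideal_graph_le_2:
  fixes S :: "'a::semigroup_mult itself"
  assumes conn: "connected (with_proj (intersection_ideal_graph S))"
    and I: "nontrivial_left_ideal (I :: 'a set)" and J: "nontrivial_left_ideal J"
  shows "graph_distance (with_proj (intersection_ideal_graph S)) I J \<le> 2"
proof -
  let ?G = "with_proj (intersection_ideal_graph S)"
  interpret pair_sym_digraph "intersection_ideal_graph S"
    by (rule pair_sym_digraph_intersection_ideal_graph)
  have "\<exists>p. awalk I p J \<and> length p \<le> 2"
  proof (cases "I \<inter> J = {}")
    case True
    obtain K where "nontrivial_left_ideal K" "K \<inter> I \<noteq> {}" "K \<inter> J \<noteq> {}"
      using disjoint_common_neighbour[OF conn I J True] .
    \<comment> \<open>Arcs need distinct ends: \<open>K = I\<close> or \<open>K = J\<close> would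
      make \<open>I\<close> and \<open>J\<close> intersect.\<close>
    with I J True have "awalk I [(I, K), (K, J)] J"
      by (auto simp: awalk_simps parcs_intersection_ideal_graph_iff
          pverts_intersection_ideal_graph_iff)
    then show ?thesis by (intro exI conjI) auto
  next
    case False
    show ?thesis
    proof (cases "I = J")
      \<comment> \<open>The graph has no loops, so equal ends are joined by the empty walk. The case
        is needed because the supremum in \<open>diameter\<close> also ranges over equal
        pairs.\<close>
      case True
      with I have "awalk I [] J"
        by (simp add: awalk_simps pverts_intersection_ideal_graph_iff)
      then show ?thesis by (intro exI conjI) auto
    next
      case ne: False
      with I J False have "awalk I [(I, J)] J"
        by (simp add: awalk_simps parcs_intersection_ideal_graph_iff
            pverts_intersection_ideal_graph_iff)
      then show ?thesis by (intro exI conjI) auto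
    qed
  qed
  then obtain p where p: "awalk I p J" "length p \<le> 2" by blast
  have "graph_distance ?G I J \<le> length p"
    using wf_digraph_intersection_ideal_graph p(1) by (rule graph_distance_le_length)
  also have "\<dots> \<le> 2"
    using p(2) by simp
  finally show ?thesis .
qed

theorem theorem3p4:
  assumes "connected (with_proj (intersection_ideal_graph TYPE('a::semigroup_mult)))"
  shows "diameter (with_proj (intersection_ideal_graph TYPE('a))) \<le> 2"
  unfolding diameter_def
proof (rule SUP_least, rule SUP_least)
  fix I J :: "'a set"
  assume "I \<in> verts (with_proj (intersection_ideal_graph TYPE('a)))"
    and "J \<in> verts (with_proj (intersection_ideal_graph TYPE('a)))"
  then have "nontrivial_left_ideal I" "nontrivial_left_ideal J"
    by (simp_all add: pverts_intersection_ideal_graph_iff)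
  then show "graph_distance (with_proj (intersection_ideal_graph TYPE('a))) I J \<le> 2"
    by (rule graph_distance_intersection_ideal_graph_le_2[OF assms])
qed

end
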